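(* Assume that at each station $n$ the steady state remaining onboard load $G^{(n)}$ and the steady state passenger queue $Q^{(n)}$ are independent. Then for each $n=1,\ldots,N$, given the distribution $g^{(n)}=[g_0^{(n)},\ldots,g_C^{(n)}]$ of $G^{(n)}$ and the probabilities $q_k^{(n)}=\mathbb{P}(Q^{(n)}=k)$, $k=0,\ldots,C-1$, the distribution $v^{(n)}=[v_0^{(n)},\ldots,v_C^{(n)}]$ of the departing vehicle load $V^{(n)}$ satisfies $$v^{(n)}=g^{(n)}B^{(n)},$$ where $B^{(n)}$ is the $(C+1)\times(C+1)$ matrix with entries, for $i,j=0,1,\ldots,C$, $$b_{ij}^{(n)}=\begin{cases} q_{j-i}^{(n)}, & 0\le i\le j<C,\\ 1-\sum_{k=0}^{C-i-1}q_k^{(n)}, & j=C,\ 0\le i<C,\\ 1,& i=j=C,\\ 0,&\text{otherwise.}\end{cases}$$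
   Context: Single transit route with stations $1,\ldots,N$ served by vehicles of integer capacity $C\ge 1$. At station $n$, in steady state: $G^{(n)}\in\{0,\ldots,C\}$ is the number of passengers remaining on board an arriving vehicle after alighting; $Q^{(n)}\in\{0,1,2,\ldots\}$ is the number of passengers queueing at the station when the vehicle arrives; $V^{(n)}$ is the vehicle load on departure from station $n$. After alighting, queueing passengers board up to the available capacity $C-G^{(n)}$, and no passenger arrives during boarding, so $V^{(n)}=\min\{C,\,G^{(n)}+Q^{(n)}\}$. The steady state distributions (limits as the vehicle run index tends to infinity) are assumed to exist. Distributions are row vectors indexed from $0$ to $C$. *)

theory Defs
  imports "HOL-Probability.Probability" "Jordan_Normal_Form.Matrix"
begin

text \<open>A sequence of discrete random variables on \<open>R\<close> has steady state \<open>Y\<close>, a random variable on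
  \<open>M\<close>, if the point probabilities converge to those of \<open>Y\<close>. As the limit is again a probability
  distribution (no mass escapes), on a countable range this is convergence in law.\<close>

definition steady_state ::
    "'a measure \<Rightarrow> (nat \<Rightarrow> 'a \<Rightarrow> 'c) \<Rightarrow> 'b measure \<Rightarrow> ('b \<Rightarrow> 'c) \<Rightarrow> bool" where
  "steady_state R X M Y \<longleftrightarrow>
    (\<forall>x. (\<lambda>r. \<P>(\<omega> in R. X r \<omega> = x)) \<longlonglongrightarrow> \<P>(\<omega> in M. Y \<omega> = x))"

text \<open>\<open>Gr n r\<close>, \<open>Qr n r\<close> and \<open>Vr n r\<close> are the remaining load, the queue and the departing load at
  station \<open>n\<close> for vehicle run \<open>r\<close>; \<open>G n\<close>, \<open>Q n\<close> and \<open>V n\<close> are the corresponding steady state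
  variables. The limit is taken jointly in the three variables, since both independence of \<open>G n\<close> and
  \<open>Q n\<close> and the relation between the three refer to a joint steady state law. The steady state
  versions of the capacity bound and of the boarding rule then hold almost surely; they are
  derived below.\<close>

locale transit_route = run: prob_space R + steady: prob_space M
  for R :: "'a measure" and M :: "'b measure" +
  fixes N C :: nat
    and Gr Qr Vr :: "nat \<Rightarrow> nat \<Rightarrow> 'a \<Rightarrow> nat"
    and G Q V :: "nat \<Rightarrow> 'b \<Rightarrow> nat"
  assumes capacity_pos: "1 \<le> C"
    and run_measurable:
      "n \<in> {1..N} \<Longrightarrow> Gr n r \<in> R \<rightarrow>\<^sub>M count_space UNIV"
      "n \<in> {1..N} \<Longrightarrow> Qr n r \<in> R \<rightarrow>\<^sub>M count_space UNIV"
      "n \<in> {1..N} \<Longrightarrow> Vr n r \<in> R \<rightarrow>\<^sub>M count_space UNIV"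
    and steady_measurable:
      "n \<in> {1..N} \<Longrightarrow> G n \<in> M \<rightarrow>\<^sub>M count_space UNIV"
      "n \<in> {1..N} \<Longrightarrow> Q n \<in> M \<rightarrow>\<^sub>M count_space UNIV"
      "n \<in> {1..N} \<Longrightarrow> V n \<in> M \<rightarrow>\<^sub>M count_space UNIV"
    and remaining_le: "n \<in> {1..N} \<Longrightarrow> \<omega> \<in> space R \<Longrightarrow> Gr n r \<omega> \<le> C"
    and boarding:
      "n \<in> {1..N} \<Longrightarrow> \<omega> \<in> space R \<Longrightarrow> Vr n r \<omega> = min C (Gr n r \<omega> + Qr n r \<omega>)"
    and steady:
      "n \<in> {1..N} \<Longrightarrow> steady_state R (\<lambda>r \<omega>. (Gr n r \<omega>, Qr n r \<omega>, Vr n r \<omega>))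
                                 M (\<lambda>\<omega>. (G n \<omega>, Q n \<omega>, V n \<omega>))"
begin

lemma steady_relations:
  assumes n: "n \<in> {1..N}"
  shows "AE \<omega> in M. G n \<omega> \<le> C \<and> V n \<omega> = min C (G n \<omega> + Q n \<omega>)"
proof -
  note [measurable] = steady_measurable[OF n]
  have null: "AE \<omega> in M. (G n \<omega>, Q n \<omega>, V n \<omega>) \<noteq> (g, q, v)"
    if bad: "\<not> (g \<le> C \<and> v = min C (g + q))" for g q v
  proof -
    have empty: "{\<omega> \<in> space R. (Gr n r \<omega>, Qr n r \<omega>, Vr n r \<omega>) = (g, q, v)} = {}" for r
      using bad remaining_le[OF n] boarding[OF n] by auto
    have "(\<lambda>r. \<P>(\<omega> in R. (Gr n r \<omega>, Qr n r \<omega>, Vr n r \<omega>) = (g, q, v)))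
        \<longlonglongrightarrow> \<P>(\<omega> in M. (G n \<omega>, Q n \<omega>, V n \<omega>) = (g, q, v))"
      using steady[OF n] unfolding steady_state_def by (rule spec)
    then have "(\<lambda>r. 0) \<longlonglongrightarrow> \<P>(\<omega> in M. (G n \<omega>, Q n \<omega>, V n \<omega>) = (g, q, v))"
      unfolding empty measure_empty .
    then have "\<P>(\<omega> in M. (G n \<omega>, Q n \<omega>, V n \<omega>) = (g, q, v)) = 0"
      using LIMSEQ_unique tendsto_const by blast
    moreover have "{\<omega> \<in> space M. (G n \<omega>, Q n \<omega>, V n \<omega>) = (g, q, v)} \<in> sets M"
      unfolding prod.inject by measurable
    ultimately show ?thesis
      by (simp only: steady.prob_Collect_eq_0 not_False_eq_True)
  qed
  have "AE \<omega> in M. \<not> (g \<le> C \<and> v = min C (g + q)) \<longrightarrow> (G n \<omega>, Q n \<omega>, V n \<omega>) \<noteq> (g, q, v)" for g q v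
    using null[of g v q] by (cases "g \<le> C \<and> v = min C (g + q)") simp_all
  then have "AE \<omega> in M. \<forall>g q v.
      \<not> (g \<le> C \<and> v = min C (g + q)) \<longrightarrow> (G n \<omega>, Q n \<omega>, V n \<omega>) \<noteq> (g, q, v)"
    unfolding AE_all_countable by blast
  then show ?thesis
    by eventually_elim blast
qed

end

text \<open>Row vectors are \<open>1 \<times> (C + 1)\<close> matrices, with columns indexed from \<open>0\<close> to \<open>C\<close>.\<close>

definition load_row :: "'b measure \<Rightarrow> nat \<Rightarrow> ('b \<Rightarrow> nat) \<Rightarrow> real Matrix.mat" where
  "load_row M C X = Matrix.mat 1 (C + 1) (\<lambda>(_, j). \<P>(\<omega> in M. X \<omega> = j))"

definition boarding_matrix :: "nat \<Rightarrow> (nat \<Rightarrow> real) \<Rightarrow> real Matrix.mat" where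
  "boarding_matrix C q = Matrix.mat (C + 1) (C + 1) (\<lambda>(i, j).
     if i \<le> j \<and> j < C then q (j - i)
     else if j = C \<and> i < C then 1 - (\<Sum>k=0..C - i - 1. q k)
     else if i = C \<and> j = C then 1
     else 0)"

end

theory Submission
  imports Defs
begin

text \<open>Given \<open>G n = i\<close>, the departing load is \<open>min C (i + Q n)\<close>.
  Independence leaves the law of \<open>Q n\<close> unchanged by this conditioning, so entry (i, j)
  of the matrix is the transition probability from remaining load i to departing load j; this is
  \<open>boarding_matrix_entry\<close>. The product formula is then the law of total probability
  over i = 0..C, where \<open>steady_relations\<close> supplies, almost surely, the bound on
  \<open>G n\<close> and the boarding rule.\<close>

lemma boarding_matrix_entry:
  fixes X :: "'b \<Rightarrow> nat"
  assumes "prob_space M"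
    and meas [measurable]: "X \<in> M \<rightarrow>\<^sub>M count_space UNIV"
    and i: "i \<le> C" and j: "j \<le> C"
  shows "boarding_matrix C (\<lambda>k. \<P>(\<omega> in M. X \<omega> = k)) $$ (i, j) =
           \<P>(\<omega> in M. min C (i + X \<omega>) = j)"
proof -
  interpret prob_space M by fact
  consider "j < C" "i \<le> j" | "j < C" "j < i" | "j = C" "i < C" | "j = C" "i = C"
    using i j by linarith
  then show ?thesis
  proof cases
    case 1
    then have "min C (i + X \<omega>) = j \<longleftrightarrow> X \<omega> = j - i" for \<omega> by auto
    with 1 show ?thesis by (simp add: boarding_matrix_def)
  next
    case 2
    \<comment> \<open>Boarding never lowers the load: both C and i + X exceed j.\<close>
    then have "min C (i + X \<omega>) \<noteq> j" for \<omega> by auto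
    with 2 i show ?thesis by (simp add: boarding_matrix_def)
  next
    case 3
    \<comment> \<open>The vehicle leaves full unless fewer than C - i passengers queue, so the entry
      is a complementary probability. Since i < C, the natural number subtraction does not
      truncate.\<close>
    have "(\<Sum>k = 0..C - i - 1. \<P>(\<omega> in M. X \<omega> = k)) = \<P>(\<omega> in M. X \<omega> \<le> C - i - 1)"
      by (rule prob_sum[symmetric]) auto
    also have "\<dots> = \<P>(\<omega> in M. \<not> min C (i + X \<omega>) = j)"
      using 3 by (intro arg_cong[of _ _ prob] Collect_cong) auto
    also have "\<dots> = 1 - \<P>(\<omega> in M. min C (i + X \<omega>) = j)"
      by (rule prob_neg) measurable
    finally show ?thesis using 3 by (simp add: boarding_matrix_def)
  next
    case 4
    then show ?thesis by (simp add: boarding_matrix_def prob_space)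
  qed
qed

theorem proposition2:
  fixes R :: "'a measure" and M :: "'b measure"
    and N C :: nat
    and Gr Qr Vr :: "nat \<Rightarrow> nat \<Rightarrow> 'a \<Rightarrow> nat"
    and G Q V :: "nat \<Rightarrow> 'b \<Rightarrow> nat"
  assumes "transit_route R M N C Gr Qr Vr G Q V"
    and "\<And>n. n \<in> {1..N} \<Longrightarrow>
           prob_space.indep_var M (count_space UNIV) (G n) (count_space UNIV) (Q n)"
  shows "\<forall>n\<in>{1..N}. load_row M C (V n) =
           load_row M C (G n) * boarding_matrix C (\<lambda>k. \<P>(\<omega> in M. Q n \<omega> = k))"
proof
  fix n assume n: "n \<in> {1..N}"
  interpret transit_route R M N C Gr Qr Vr G Q V by fact
  note [measurable] = steady_measurable[OF n]
  let ?B = "boarding_matrix C (\<lambda>k. \<P>(\<omega> in M. Q n \<omega> = k))"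
  have "\<P>(\<omega> in M. V n \<omega> = j) = (\<Sum>i\<in>{0..<C + 1}. \<P>(\<omega> in M. G n \<omega> = i) * ?B $$ (i, j))"
    if j: "j \<le> C" for j
  proof -
    have "\<P>(\<omega> in M. V n \<omega> = j)
        = (\<Sum>i\<in>{0..<C + 1}. \<P>(\<omega> in M. G n \<omega> = i \<and> min C (i + Q n \<omega>) = j))"
      \<comment> \<open>\<open>prob_sum\<close> needs its events to partition \<open>V n = j\<close>
        only almost surely, which is all that the limit law provides. The bound
        \<open>G n \<le> C\<close> makes i = 0..C exhaustive.\<close>
      using steady_relations[OF n] by (intro steady.prob_sum) auto
    also have "\<dots> = (\<Sum>i\<in>{0..<C + 1}. \<P>(\<omega> in M. G n \<omega> = i) * ?B $$ (i, j))"
    proof (rule sum.cong[OF refl])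
      fix i assume "i \<in> {0..<C + 1}"
      then have i: "i \<le> C" by simp
      have "\<P>(\<omega> in M. G n \<omega> = i \<and> min C (i + Q n \<omega>) = j)
          = \<P>(\<omega> in M. G n \<omega> = i) * \<P>(\<omega> in M. min C (i + Q n \<omega>) = j)"
        \<comment> \<open>With i fixed, the boarding condition is an event about \<open>Q n\<close>
          alone, so independence factors the joint probability.\<close>
        using steady.indep_varD[OF assms(2)[OF n], of "{i}" "{k. min C (i + k) = j}"]
        by (simp add: vimage_def Int_def conj_commute)
      then show "\<P>(\<omega> in M. G n \<omega> = i \<and> min C (i + Q n \<omega>) = j)
          = \<P>(\<omega> in M. G n \<omega> = i) * ?B $$ (i, j)"
        using boarding_matrix_entry[OF steady.prob_space_axioms steady_measurable(2)[OF n] i j]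
        by simp
    qed
    finally show ?thesis .
  qed
  then show "load_row M C (V n) = load_row M C (G n) * ?B"
    by (intro eq_matI) (auto simp: load_row_def scalar_prod_def boarding_matrix_def)
qed

end
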